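(* Let $n$, $k$, $t$ and $s$ be positive integers with $k\geq t+1$ and $n\geq 2(t+1)\left((k-t+1)^{2}+s\right)$. If $\mathcal{F}\subseteq \binom{[n]}{k}$ is an $s$-almost $t$-intersecting family of maximum size (among all $s$-almost $t$-intersecting subfamilies of $\binom{[n]}{k}$), then $\mathcal{F}\cong \left\{F\in\binom{[n]}{k}: [t]\subseteq F\right\}$.
   Context: $[n]=\{1,\dots,n\}$ and $\binom{X}{k}$ denotes the family of all $k$-subsets of a set $X$. A family $\mathcal{F}\subseteq\binom{[n]}{k}$ is called $s$-almost $t$-intersecting if $\left|\{F'\in\mathcal{F}: |F'\cap F|<t\}\right|\leq s$ for every $F\in\mathcal{F}$; it is $t$-intersecting if this holds with $s=0$. For families $\mathcal{F},\mathcal{G}$ of subsets of $[n]$, $\mathcal{F}\cong\mathcal{G}$ means there is a permutation of $[n]$ mapping $\mathcal{F}$ onto $\mathcal{G}$. *)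

theory Defs
  imports "HOL-Library.Ramsey" "HOL-Combinatorics.Permutations"
begin

text \<open>
  The set \<open>[n]\<close> is \<open>{1..n}\<close> and the family of its \<open>k\<close>-subsets is \<open>nsets {1..n} k\<close>.
\<close>

definition almost_intersecting ::
  "nat \<Rightarrow> nat \<Rightarrow> nat \<Rightarrow> nat \<Rightarrow> nat set set \<Rightarrow> bool"
  where "almost_intersecting n k s t \<F> \<longleftrightarrow>
    \<F> \<subseteq> nsets {1..n} k \<and>
    (\<forall>F\<in>\<F>. card {F' \<in> \<F>. card (F' \<inter> F) < t} \<le> s)"

definition max_almost_intersecting ::
  "nat \<Rightarrow> nat \<Rightarrow> nat \<Rightarrow> nat \<Rightarrow> nat set set \<Rightarrow> bool"
  where "max_almost_intersecting n k s t \<F> \<longleftrightarrow>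
    almost_intersecting n k s t \<F> \<and>
    (\<forall>\<G>. almost_intersecting n k s t \<G> \<longrightarrow> card \<G> \<le> card \<F>)"

text \<open>Intended for families of subsets of \<open>{1..n}\<close>.\<close>

definition family_iso :: "nat \<Rightarrow> nat set set \<Rightarrow> nat set set \<Rightarrow> bool"
  where "family_iso n \<F> \<G> \<longleftrightarrow> (\<exists>\<pi>. \<pi> permutes {1..n} \<and> (\<lambda>F. \<pi> ` F) ` \<F> = \<G>)"

end

theory Submission
  imports Defs
begin

text \<open>
  Write \<open>x = k - t\<close>, and let \<open>\<F>(H)\<close> be the set of members of \<open>\<F>\<close> that contain \<open>H\<close>. Suppose
  that \<open>|H| \<ge> t\<close> and that some member \<open>G\<close> of \<open>\<F>\<close> meets \<open>H\<close> in fewer than \<open>t\<close> points. All but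
  \<open>s\<close> members of \<open>\<F>(H)\<close> meet \<open>G\<close> in at least \<open>t\<close> points, hence hit every \<open>(x + 1)\<close>-subset of
  \<open>G - H\<close>, so that \<open>|\<F>(H)| \<le> s + (x + 1) max |\<F>(H \<union> {w})|\<close>. The bound on \<open>n\<close> enters through
  \<open>2 (t + 1) (s + (x + 1) C (i + 1)) \<le> C i\<close> for \<open>C i = (n - t - i) choose (x - i)\<close>.
  Suppose that no \<open>t\<close>-set lies in all members of \<open>\<F>\<close>, and take the least \<open>r \<ge> 1\<close> for which
  some set of size \<open>t + r\<close> meets all but at most \<open>s\<close> members of \<open>\<F>\<close> in at least \<open>t\<close> points.
  The members of \<open>\<F>\<close> show that \<open>r \<le> x\<close>. Iterating the inequality from level \<open>t\<close> up to level
  \<open>t + r\<close> bounds \<open>|\<F>(T)|\<close> for all \<open>t\<close>-sets \<open>T\<close>, and summing over the at most \<open>(t + 1)^r\<close>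
  \<open>t\<close>-subsets of the chosen set gives \<open>|\<F>| < (n - t) choose (k - t)\<close>.
\<close>

section \<open>Binomial coefficients\<close>

lemma less_binomial:
  assumes "j < m"
  shows "j < m choose j"
proof -
  have "Suc j choose j \<le> m choose j"
    using assms by (intro binomial_right_mono) simp
  then show ?thesis by simp
qed

text \<open>Raising \<open>r\<close> by one multiplies the left side by
  \<open>(t + r + 1) / (r + 1)\<close>, which is at most \<open>t + 1\<close>. The power form
  matches the factor \<open>t + 1\<close> gained per level by the iteration.\<close>

lemma binomial_add_le_power: "(t + r) choose t \<le> (t + 1) ^ r" for t r :: nat
proof (induction r)
  case 0
  then show ?case by simp
next
  case (Suc r)
  have "Suc r * ((t + Suc r) choose t) = Suc r * (Suc (t + r) choose Suc r)"
    by (simp add: binomial_symmetric[of t])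
  also have "\<dots> = (t + Suc r) * ((t + r) choose t)"
    using binomial_symmetric[of t "t + r"] binomial_absorption[of r "Suc (t + r)"]
    by (simp del: binomial_Suc_Suc)
  also have "\<dots> \<le> (Suc r * (t + 1)) * (t + 1) ^ r"
    using Suc by (intro mult_mono) auto
  also have "\<dots> = Suc r * (t + 1) ^ Suc r"
    by (simp only: power_Suc mult.assoc)
  finally show ?case
    using mult_le_cancel1 by blast
qed

section \<open>Sizes and symmetry of stars\<close>

lemma card_subset_family_le_binomial:
  assumes "finite V" "\<F> \<subseteq> nsets V k" "\<And>F. F \<in> \<F> \<Longrightarrow> H \<subseteq> F" "card H \<le> k"
  shows "card \<F> \<le> (card V - card H) choose (k - card H)"
\<comment> \<open>Only a member of \<open>\<F>\<close> can witness \<open>H \<subseteq> V\<close>,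
  so the empty family is treated apart.\<close>
proof (cases "\<F> = {}")
  case False
  then have "H \<subseteq> V"
    using assms(2,3) unfolding nsets_def by blast
  then have fin: "finite H"
    using assms(1) finite_subset by blast
  have "inj_on (\<lambda>F. F - H) \<F>"
    using assms(3) by (intro inj_onI) blast
  moreover have "(\<lambda>F. F - H) ` \<F> \<subseteq> {B. B \<subseteq> V - H \<and> card B = k - card H}"
    using assms(2,3) fin by (auto simp: nsets_def card_Diff_subset)
  ultimately have "card \<F> \<le> card {B. B \<subseteq> V - H \<and> card B = k - card H}"
    using assms(1) by (intro card_inj_on_le) auto
  also have "\<dots> = (card V - card H) choose (k - card H)"
    using n_subsets[of "V - H"] assms(1) \<open>H \<subseteq> V\<close> fin by (simp add: card_Diff_subset)
  finally show ?thesis .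
qed simp

lemma card_star:
  assumes "finite V" "T \<subseteq> V" "card T \<le> k"
  shows "card {F \<in> nsets V k. T \<subseteq> F} = (card V - card T) choose (k - card T)"
proof -
  have fin: "finite T"
    using assms finite_subset by blast
  have "bij_betw (\<lambda>B. B \<union> T) {B. B \<subseteq> V - T \<and> card B = k - card T} {F \<in> nsets V k. T \<subseteq> F}"
  proof (rule bij_betw_byWitness[where f' = "\<lambda>F. F - T"])
    show "(\<lambda>B. B \<union> T) ` {B. B \<subseteq> V - T \<and> card B = k - card T} \<subseteq> {F \<in> nsets V k. T \<subseteq> F}"
    proof clarify
      fix B assume B: "B \<subseteq> V - T" "card B = k - card T"
      then have "finite B" "B \<inter> T = {}"
        using assms(1) finite_subset by auto
      then show "B \<union> T \<in> nsets V k \<and> T \<subseteq> B \<union> T"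
        using B assms fin by (auto simp: nsets_def card_Un_disjoint)
    qed
    show "(\<lambda>F. F - T) ` {F \<in> nsets V k. T \<subseteq> F} \<subseteq> {B. B \<subseteq> V - T \<and> card B = k - card T}"
      using fin by (auto simp: nsets_def card_Diff_subset)
  qed auto
  from bij_betw_same_card[OF this] show ?thesis
    using n_subsets[of "V - T" "k - card T"] assms fin
    by (simp add: card_Diff_subset)
qed

text \<open>Any two members share \<open>T\<close>, so there are no exceptions and every
  \<open>s\<close> is allowed; stars thus compete for the maximum.\<close>

lemma star_almost_intersecting:
  assumes "card T = t" "finite T"
  shows "almost_intersecting n k s t {F \<in> nsets {1..n} k. T \<subseteq> F}"
proof -
  have "\<not> card (F' \<inter> F) < t" if "finite F" "T \<subseteq> F" "T \<subseteq> F'" for F F' :: "nat set"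
    using that assms card_mono[of "F' \<inter> F" T] by auto
  then have "card {F' \<in> {F \<in> nsets {1..n} k. T \<subseteq> F}. card (F' \<inter> F) < t} = 0"
    if "F \<in> {F \<in> nsets {1..n} k. T \<subseteq> F}" for F
    using that by (intro card_eq_0_iff[THEN iffD2] disjI1) (auto simp: nsets_def)
  then show ?thesis
    unfolding almost_intersecting_def by simp
qed

text \<open>Glue a bijection from \<open>A\<close> to \<open>B\<close> with one between the
  complements in \<open>V\<close>, and fix everything outside \<open>V\<close>.\<close>

lemma permutes_image_eq:
  assumes "finite V" "A \<subseteq> V" "B \<subseteq> V" "card A = card B"
  obtains \<pi> where "\<pi> permutes V" "\<pi> ` A = B"
proof -
  have fin: "finite A" "finite B"
    using assms finite_subset by auto
  obtain f where f: "bij_betw f A B"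
    using finite_same_card_bij[OF fin assms(4)] by blast
  have "card (V - A) = card (V - B)"
    using assms fin by (simp add: card_Diff_subset)
  then obtain g where g: "bij_betw g (V - A) (V - B)"
    using finite_same_card_bij[of "V - A" "V - B"] assms(1) by blast
  define \<pi> where "\<pi> = (\<lambda>v. if v \<in> A then f v else if v \<in> V then g v else v)"
  have \<pi>A: "bij_betw \<pi> A B"
    using f by (rule bij_betw_cong[THEN iffD1, rotated]) (simp add: \<pi>_def)
  have "bij_betw \<pi> (V - A) (V - B)"
    using g by (rule bij_betw_cong[THEN iffD1, rotated]) (auto simp: \<pi>_def)
  then have "bij_betw \<pi> (A \<union> (V - A)) (B \<union> (V - B))"
    using \<pi>A by (intro bij_betw_combine) auto
  then have "bij_betw \<pi> V V"
    using assms(2,3) by (simp add: Un_absorb1)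
  then have "\<pi> permutes V"
    using assms(2) by (intro bij_imp_permutes) (auto simp: \<pi>_def)
  then show ?thesis
    using that \<pi>A by (auto simp: bij_betw_def)
qed

lemma family_iso_star:
  assumes "A \<subseteq> {1..n}" "B \<subseteq> {1..n}" "card A = card B"
  shows "family_iso n {F \<in> nsets {1..n} k. A \<subseteq> F} {F \<in> nsets {1..n} k. B \<subseteq> F}"
proof -
  obtain \<pi> where \<pi>: "\<pi> permutes {1..n}" "\<pi> ` A = B"
    using permutes_image_eq[OF _ assms] by auto
  have nsets: "\<sigma> ` F \<in> nsets {1..n} k" if "\<sigma> permutes {1..n}" "F \<in> nsets {1..n} k" for \<sigma> F
    using that permutes_inj_on[OF that(1)] image_mono[of F "{1..n}" \<sigma>] permutes_image[OF that(1)]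
    by (simp add: nsets_def card_image)
  have inv: "\<pi> ` inv \<pi> ` F = F" for F
    using permutes_inverses(1)[OF \<pi>(1)] by (simp add: image_image)
  have "F \<in> (\<lambda>F. \<pi> ` F) ` {F \<in> nsets {1..n} k. A \<subseteq> F}"
    if "F \<in> nsets {1..n} k" "B \<subseteq> F" for F
  proof (rule image_eqI)
    show "F = \<pi> ` inv \<pi> ` F"
      using inv by simp
    have "A = inv \<pi> ` B"
      using \<pi> permutes_inverses(2)[OF \<pi>(1)] by (auto simp: image_image)
    then show "inv \<pi> ` F \<in> {F \<in> nsets {1..n} k. A \<subseteq> F}"
      using that nsets[OF permutes_inv[OF \<pi>(1)]] by auto
  qed
  moreover have "(\<lambda>F. \<pi> ` F) ` {F \<in> nsets {1..n} k. A \<subseteq> F} \<subseteq> {F \<in> nsets {1..n} k. B \<subseteq> F}"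
    using nsets[OF \<pi>(1)] \<pi>(2) by auto
  ultimately show ?thesis
    unfolding family_iso_def using \<pi>(1) by blast
qed

section \<open>Consequences of the lower bound on \<open>n\<close>\<close>

lemma threshold_large:
  fixes n x t s :: nat
  assumes "n \<ge> 2 * (t + 1) * ((x + 1)^2 + s)"
  shows "t + x < n"
proof -
  have "t + x < (t + 1) * (x + 1)"
    by simp
  also have "\<dots> \<le> (2 * (t + 1)) * ((x + 1)^2 + s)"
    by (intro mult_le_mono) (auto simp: power2_eq_square)
  finally show ?thesis
    using assms by linarith
qed

lemma binomial_gap:
  fixes n x t s i :: nat
  assumes n: "n \<ge> 2 * (t + 1) * ((x + 1)^2 + s)" and i: "i < x"
  shows "2 * (t + 1) * (s + (x + 1) * ((n - t - Suc i) choose (x - Suc i)))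
    \<le> (n - t - i) choose (x - i)"
proof -
  define y where "y = x - i"
  define M where "M = n - t - i"
  define D where "D = (M - 1) choose (y - 1)"
  have y: "y > 0" "x = y + i"
    using i by (auto simp: y_def)
  \<comment> \<open>Since \<open>x + 1 - y = 1 + i\<close>, replacing one factor
    \<open>x + 1\<close> by \<open>y\<close> leaves enough slack to pay for the shift from
    \<open>n\<close> to \<open>M = n - t - i\<close>.\<close>
  have "2 * (t + 1) * ((x + 1) * y + s) + t + i
      \<le> 2 * (t + 1) * ((x + 1) * y + s) + 2 * (t + 1) * (x + 1) * (1 + i)"
    using i by (simp add: algebra_simps)
  also have "\<dots> = 2 * (t + 1) * ((x + 1)^2 + s)"
    by (simp add: y(2) algebra_simps power2_eq_square)
  finally have M: "2 * (t + 1) * ((x + 1) * y + s) \<le> M"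
    using n unfolding M_def by simp
  have "y < M"
  proof -
    have "y < 2 * (t + 1) * ((x + 1) * y + s)"
      using y by (simp add: algebra_simps)
    then show ?thesis using M by linarith
  qed
  then have D: "y \<le> D"
    using less_binomial[of "y - 1" "M - 1"] y(1) unfolding D_def by linarith
  \<comment> \<open>The factor \<open>y\<close> prepares for the absorption identity
    \<open>y * (M choose y) = M * D\<close>; \<open>y \<le> D\<close> then turns
    \<open>s * y\<close> into a multiple of \<open>D\<close>.\<close>
  have "y * (2 * (t + 1) * (s + (x + 1) * D)) = 2 * (t + 1) * ((x + 1) * y * D + s * y)"
    by (simp add: algebra_simps)
  also have "\<dots> \<le> 2 * (t + 1) * ((x + 1) * y * D + s * D)"
    using D by (intro mult_le_mono add_mono) auto
  also have "\<dots> = 2 * (t + 1) * ((x + 1) * y + s) * D"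
    by (simp add: algebra_simps)
  also have "\<dots> \<le> M * D"
    using M by (rule mult_le_mono1)
  also have "\<dots> = y * (M choose y)"
    unfolding D_def using times_binomial_minus1_eq[OF y(1)] by simp
  finally have "2 * (t + 1) * (s + (x + 1) * D) \<le> M choose y"
    using y(1) by simp
  then show ?thesis
    by (simp add: D_def M_def y_def)
qed

section \<open>Counting inequalities for families\<close>

lemma card_containing_step:
  fixes \<F> :: "'a set set"
  assumes finF: "finite \<F>" and H: "finite H" "t \<le> card H"
    and G: "G \<in> \<F>" "finite G" "card G = t + x" "card (H \<inter> G) < t"
    and bad: "card {F \<in> \<F>. card (F \<inter> G) < t} \<le> s"
    and ext: "\<And>w. w \<notin> H \<Longrightarrow> card {F \<in> \<F>. insert w H \<subseteq> F} \<le> m"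
  shows "card {F \<in> \<F>. H \<subseteq> F} \<le> s + (x + 1) * m"
proof -
  have diff: "card (G - H) = t + x - card (H \<inter> G)"
    using G H by (simp add: card_Diff_subset_Int Int_commute)
  then have "x + 1 \<le> card (G - H)"
    using G(4) by linarith
  then obtain W where W: "W \<subseteq> G - H" "card W = x + 1"
    by (rule obtain_subset_with_card_n)
  then have finW: "finite W"
    using G(2) finite_subset by blast
  have sub: "{F \<in> \<F>. H \<subseteq> F} \<subseteq> {F \<in> \<F>. card (F \<inter> G) < t} \<union> (\<Union>w\<in>W. {F \<in> \<F>. insert w H \<subseteq> F})"
  proof clarify
    fix F assume F: "F \<in> \<F>" "H \<subseteq> F" "F \<notin> (\<Union>w\<in>W. {F \<in> \<F>. insert w H \<subseteq> F})"
    then have "F \<inter> W = {}" by auto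
    \<comment> \<open>A set missing the \<open>x + 1\<close> points of \<open>W\<close> retains at
      most \<open>t - 1\<close> of the \<open>t + x\<close> points of \<open>G\<close>.\<close>
    then have "F \<inter> G \<subseteq> (H \<inter> G) \<union> ((G - H) - W)"
      by blast
    then have "card (F \<inter> G) \<le> card ((H \<inter> G) \<union> ((G - H) - W))"
      using G(2) by (intro card_mono) auto
    also have "\<dots> \<le> card (H \<inter> G) + card ((G - H) - W)"
      by (rule card_Un_le)
    also have "card ((G - H) - W) = t + x - card (H \<inter> G) - (x + 1)"
      using W finW diff by (simp add: card_Diff_subset)
    finally show "card (F \<inter> G) < t"
      using G(4) by linarith
  qed
  have "card {F \<in> \<F>. H \<subseteq> F}
      \<le> card ({F \<in> \<F>. card (F \<inter> G) < t} \<union> (\<Union>w\<in>W. {F \<in> \<F>. insert w H \<subseteq> F}))"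
    using sub finF finW by (intro card_mono) auto
  also have "\<dots> \<le> card {F \<in> \<F>. card (F \<inter> G) < t} + card (\<Union>w\<in>W. {F \<in> \<F>. insert w H \<subseteq> F})"
    by (rule card_Un_le)
  also have "\<dots> \<le> s + (\<Sum>w\<in>W. card {F \<in> \<F>. insert w H \<subseteq> F})"
    using bad card_UN_le[OF finW] by (intro add_mono)
  also have "\<dots> \<le> s + card W * m"
    using sum_bounded_above[of W "\<lambda>w. card {F \<in> \<F>. insert w H \<subseteq> F}" m] ext W(1) by auto
  finally show ?thesis
    using W(2) by simp
qed

text \<open>Apart from at most \<open>s\<close> exceptions, each member contains some
  \<open>t\<close>-subset of \<open>H\<close>; a union bound over these subsets suffices.\<close>

lemma card_le_quasi_cover:
  fixes \<F> :: "'a set set"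
  assumes finF: "finite \<F>" and H: "finite H"
    and bad: "card {F \<in> \<F>. card (F \<inter> H) < t} \<le> s"
    and T: "\<And>T. finite T \<Longrightarrow> card T = t \<Longrightarrow> card {F \<in> \<F>. T \<subseteq> F} \<le> m"
  shows "card \<F> \<le> s + (card H choose t) * m"
proof -
  have finTs: "finite {T. T \<subseteq> H \<and> card T = t}"
    using H by simp
  have sub: "\<F> \<subseteq> {F \<in> \<F>. card (F \<inter> H) < t} \<union> (\<Union>T\<in>{T. T \<subseteq> H \<and> card T = t}. {F \<in> \<F>. T \<subseteq> F})"
  proof
    fix F assume F: "F \<in> \<F>"
    show "F \<in> {F \<in> \<F>. card (F \<inter> H) < t} \<union> (\<Union>T\<in>{T. T \<subseteq> H \<and> card T = t}. {F \<in> \<F>. T \<subseteq> F})"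
    proof (cases "card (F \<inter> H) < t")
      case False
      then have "t \<le> card (F \<inter> H)" by simp
      then obtain T where "T \<subseteq> F \<inter> H" "card T = t"
        by (rule obtain_subset_with_card_n)
      then show ?thesis using F by blast
    qed (use F in simp)
  qed
  have "card \<F> \<le> card ({F \<in> \<F>. card (F \<inter> H) < t}
      \<union> (\<Union>T\<in>{T. T \<subseteq> H \<and> card T = t}. {F \<in> \<F>. T \<subseteq> F}))"
    using sub finF finTs by (intro card_mono) auto
  also have "\<dots> \<le> card {F \<in> \<F>. card (F \<inter> H) < t}
      + card (\<Union>T\<in>{T. T \<subseteq> H \<and> card T = t}. {F \<in> \<F>. T \<subseteq> F})"
    by (rule card_Un_le)
  also have "\<dots> \<le> s + (\<Sum>T\<in>{T. T \<subseteq> H \<and> card T = t}. card {F \<in> \<F>. T \<subseteq> F})"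
    using bad card_UN_le[OF finTs] by (intro add_mono)
  also have "\<dots> \<le> s + card {T. T \<subseteq> H \<and> card T = t} * m"
    using sum_bounded_above[of "{T. T \<subseteq> H \<and> card T = t}" "\<lambda>T. card {F \<in> \<F>. T \<subseteq> F}" m]
      T finite_subset[OF _ H] by auto
  also have "card {T. T \<subseteq> H \<and> card T = t} = card H choose t"
    using H by (rule n_subsets)
  finally show ?thesis .
qed

section \<open>Families without a common \<open>t\<close>-set\<close>

lemma almost_intersecting_card_less:
  fixes n x t s :: nat
  assumes F: "almost_intersecting n (t + x) s t \<F>" "\<F> \<noteq> {}"
    and n: "n \<ge> 2 * (t + 1) * ((x + 1)^2 + s)" and x: "x > 0"
    and nostar: "\<And>T. finite T \<Longrightarrow> card T = t \<Longrightarrow> \<exists>F\<in>\<F>. \<not> T \<subseteq> F"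
  shows "card \<F> < (n - t) choose x"
proof -
  define a where "a = t + 1"
  define q where "q = x + 1"
  define C where "C i = (n - t - i) choose (x - i)" for i
  \<comment> \<open>The value 0 is excluded so that at least one step is made. A
    \<open>t\<close>-set may be missed by few members, but \<open>nostar\<close> still gives one
    member not containing it, which is all that level \<open>t\<close> requires.\<close>
  define Q where "Q r \<longleftrightarrow> 0 < r \<and>
    (\<exists>H. finite H \<and> card H = t + r \<and> card {F \<in> \<F>. card (F \<inter> H) < t} \<le> s)" for r
  have memF: "F \<subseteq> {1..n}" "finite F" "card F = t + x" if "F \<in> \<F>" for F
    using that F(1) by (auto simp: almost_intersecting_def nsets_def)
  have bad: "card {F' \<in> \<F>. card (F' \<inter> F) < t} \<le> s" if "F \<in> \<F>" for F
    using that F(1) by (auto simp: almost_intersecting_def)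
  have subF: "\<F> \<subseteq> nsets {1..n} (t + x)"
    using F(1) by (simp add: almost_intersecting_def)
  then have finF: "finite \<F>"
    using finite_imp_finite_nsets finite_subset by blast
  have gap: "2 * a * (s + q * C (Suc i)) \<le> C i" if "i < x" for i
    using binomial_gap[OF n that] unfolding C_def a_def q_def by simp

  have "Q x"
  proof -
    obtain F where "F \<in> \<F>" using F(2) by blast
    then show ?thesis
      unfolding Q_def using x memF[of F] bad[of F] by blast
  qed
  define r where "r = (LEAST r. Q r)"
  have "Q r" and "r \<le> x"
    unfolding r_def using \<open>Q x\<close> by (auto intro: LeastI Least_le)
  have "r > 0"
    using \<open>Q r\<close> Q_def by blast
  have noncover: "\<exists>G\<in>\<F>. card (H \<inter> G) < t" if H: "finite H" "card H = t + i" "i < r" for H i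
  proof (cases "i = 0")
    case True
    then obtain G where G: "G \<in> \<F>" "\<not> H \<subseteq> G"
      using nostar[of H] H by auto
    then have "card (H \<inter> G) < card H"
      using H(1) by (intro psubset_card_mono) auto
    then show ?thesis using G True H by auto
  next
    case False
    have "\<not> Q i"
      using H(3) not_less_Least unfolding r_def by blast
    then have "card {F \<in> \<F>. card (F \<inter> H) < t} > s"
      using False H unfolding Q_def by auto
    then have "{F \<in> \<F>. card (F \<inter> H) < t} \<noteq> {}"
      by (metis card.empty not_less_zero)
    then show ?thesis
      by (auto simp: Int_commute)
  qed
  have step: "card {F \<in> \<F>. H \<subseteq> F} \<le> s + q * m"
    if H: "finite H" "card H = t + i" "i < r"
      and m: "\<And>H. finite H \<Longrightarrow> card H = t + Suc i \<Longrightarrow> card {F \<in> \<F>. H \<subseteq> F} \<le> m" for H i m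
  proof -
    obtain G where G: "G \<in> \<F>" "card (H \<inter> G) < t"
      using noncover[OF H] by blast
    have "card {F \<in> \<F>. insert w H \<subseteq> F} \<le> m" if "w \<notin> H" for w
      using m[of "insert w H"] that H by simp
    then show ?thesis
      unfolding q_def using H G memF(2,3)[OF G(1)] bad[OF G(1)] finF
      by (intro card_containing_step[where G = G and t = t]) simp_all
  qed
  \<comment> \<open>The lower bound \<open>s \<le> m\<close> absorbs the additive \<open>s\<close> of each further step.\<close>
  have iter: "\<exists>m. s \<le> m \<and> 2 * a ^ d * m \<le> C (r - d) \<and>
      (\<forall>H. finite H \<and> card H = t + (r - d) \<longrightarrow> card {F \<in> \<F>. H \<subseteq> F} \<le> m)"
    if "1 \<le> d" "d \<le> r" for d
    using that
  proof (induction d rule: nat_induct_at_least)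
    \<comment> \<open>Starting at \<open>d = 0\<close> with the trivial bound \<open>m = C r\<close>
      would fail: \<open>2 * m \<le> C r\<close> is false there, and \<open>C r\<close> may be
      smaller than \<open>s\<close>. One step from level \<open>r\<close> supplies both
      conditions.\<close>
    case base
    have top: "card {F \<in> \<F>. H \<subseteq> F} \<le> C r" if "card H = t + Suc (r - 1)" for H
    proof -
      have H: "card H = t + r"
        using that \<open>r > 0\<close> by simp
      have "{F \<in> \<F>. H \<subseteq> F} \<subseteq> nsets {1..n} (t + x)"
        using subF by blast
      then have "card {F \<in> \<F>. H \<subseteq> F} \<le> (card {1..n} - card H) choose (t + x - card H)"
        using H \<open>r \<le> x\<close> by (intro card_subset_family_le_binomial) auto
      then show ?thesis
        by (simp add: C_def H)
    qed
    have "card {F \<in> \<F>. H \<subseteq> F} \<le> s + q * C r" if "finite H" "card H = t + (r - 1)" for H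
      using \<open>r > 0\<close> by (intro step[OF that _ top]) simp_all
    moreover have "2 * a ^ 1 * (s + q * C r) \<le> C (r - 1)"
      using gap[of "r - 1"] \<open>r > 0\<close> \<open>r \<le> x\<close> by simp
    ultimately show ?case
      by (intro exI[of _ "s + q * C r"]) auto
  next
    case (Suc d)
    then obtain m where m: "s \<le> m" "2 * a ^ d * m \<le> C (r - d)"
      "\<And>H. finite H \<Longrightarrow> card H = t + (r - d) \<Longrightarrow> card {F \<in> \<F>. H \<subseteq> F} \<le> m"
      by auto
    have rd: "r - d = Suc (r - Suc d)"
      using Suc.prems by simp
    have "card {F \<in> \<F>. H \<subseteq> F} \<le> s + q * m" if "finite H" "card H = t + (r - Suc d)" for H
      using step[OF that] m(3) Suc.prems unfolding rd by simp
    moreover have "2 * a ^ Suc d * (s + q * m) \<le> C (r - Suc d)"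
    proof -
      have "a ^ d * s \<le> a ^ d * (q * m)"
        using m(1) by (intro mult_le_mono) (auto simp: q_def)
      \<comment> \<open>Absorbing \<open>s\<close> costs a factor 2, paid by the 2 in the induction
        hypothesis; the 2 in \<open>gap\<close> restores it for the next level.\<close>
      then have "a ^ d * (s + q * m) \<le> 2 * (a ^ d * (q * m))"
        unfolding distrib_left by linarith
      also have "\<dots> \<le> s + q * (2 * a ^ d * m)"
        by (simp add: ac_simps)
      also have "\<dots> \<le> s + q * C (r - d)"
        using m(2) by simp
      finally have "2 * a * (a ^ d * (s + q * m)) \<le> 2 * a * (s + q * C (r - d))"
        by (rule mult_le_mono2)
      also have "\<dots> \<le> C (r - Suc d)"
        using gap[of "r - Suc d"] Suc.prems \<open>r \<le> x\<close> unfolding rd by simp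
      finally show ?thesis
        by (simp only: power_Suc mult.assoc)
    qed
    ultimately show ?case
      by (intro exI[of _ "s + q * m"]) auto
  qed
  obtain m where m: "2 * a ^ r * m \<le> C 0"
    "\<And>T. finite T \<Longrightarrow> card T = t \<Longrightarrow> card {F \<in> \<F>. T \<subseteq> F} \<le> m"
    using iter[of r] \<open>r > 0\<close> by auto
  obtain H where H: "finite H" "card H = t + r" "card {F \<in> \<F>. card (F \<inter> H) < t} \<le> s"
    using \<open>Q r\<close> Q_def by blast
  \<comment> \<open>The number of \<open>t\<close>-subsets is at most \<open>a ^ r\<close>, which
    cancels the gain in \<open>m\<close>, so the product is at most half of \<open>C 0\<close>. The
    other half has to exceed \<open>s\<close>.\<close>
  have "card \<F> \<le> s + ((t + r) choose t) * m"
    using card_le_quasi_cover[OF finF H(1,3) m(2)] H(2) by simp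
  also have "\<dots> \<le> s + a ^ r * m"
    unfolding a_def using binomial_add_le_power by (intro add_mono mult_le_mono) auto
  finally have "2 * card \<F> \<le> 2 * s + C 0"
    using m(1) by simp
  moreover have "2 * s < C 0"
  proof -
    have "0 < C (Suc 0)"
      using threshold_large[OF n] unfolding C_def by (simp add: zero_less_binomial_iff)
    then have "2 * 1 * (s + 1 * 1) \<le> 2 * a * (s + q * C (Suc 0))"
      by (intro mult_le_mono add_mono) (auto simp: a_def q_def)
    then show ?thesis
      using gap[of 0] x by simp
  qed
  ultimately show ?thesis
    unfolding C_def by simp
qed

section \<open>From the size bound to the extremal families\<close>

theorem theorem1p1:
  fixes n k t s :: nat and \<F> :: "nat set set"
  assumes "n > 0" and "k > 0" and "t > 0" and "s > 0"
    and "k \<ge> t + 1"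
    and "n \<ge> 2 * (t + 1) * ((k - t + 1)^2 + s)"
    and "max_almost_intersecting n k s t \<F>"
  shows "family_iso n \<F> {F \<in> nsets {1..n} k. {1..t} \<subseteq> F}"
proof -
  have "t + (k - t) < n"
    using threshold_large[OF assms(6)] .
  then have "t \<le> n" and "k - t \<le> n - t"
    by linarith+
  have F: "almost_intersecting n k s t \<F>"
    and max: "\<And>\<G>. almost_intersecting n k s t \<G> \<Longrightarrow> card \<G> \<le> card \<F>"
    using assms(7) by (auto simp: max_almost_intersecting_def)
  have "card {F \<in> nsets {1..n} k. {1..t} \<subseteq> F} = (n - t) choose (k - t)"
    using card_star[of "{1..n}" "{1..t}" k] \<open>t \<le> n\<close> \<open>k \<ge> t + 1\<close> by simp
  then have large: "(n - t) choose (k - t) \<le> card \<F>"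
    using max[OF star_almost_intersecting, of "{1..t}"] by simp
  then have "\<F> \<noteq> {}"
    using \<open>k - t \<le> n - t\<close> by (auto simp: binomial_eq_0_iff)
  \<comment> \<open>As \<open>\<F>\<close> is at least as large as a star, the strict bound fails,
    which forces a common \<open>t\<close>-set.\<close>
  obtain T where T: "finite T" "card T = t" "\<And>F. F \<in> \<F> \<Longrightarrow> T \<subseteq> F"
    using almost_intersecting_card_less[of n t "k - t" s \<F>] F \<open>\<F> \<noteq> {}\<close> assms(5,6) large
    by fastforce
  have sub: "\<F> \<subseteq> nsets {1..n} k"
    using F by (simp add: almost_intersecting_def)
  then have "T \<subseteq> {1..n}"
    using T(3) \<open>\<F> \<noteq> {}\<close> unfolding nsets_def by blast
  \<comment> \<open>Maximality enters again: the star of \<open>T\<close> contains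
    \<open>\<F>\<close> and is itself a competitor, so it cannot be larger.\<close>
  have "\<F> = {F \<in> nsets {1..n} k. T \<subseteq> F}"
  proof (rule card_subset_eq)
    show "finite {F \<in> nsets {1..n} k. T \<subseteq> F}"
      by (simp add: finite_imp_finite_nsets)
    show "\<F> \<subseteq> {F \<in> nsets {1..n} k. T \<subseteq> F}"
      using sub T(3) by auto
    then have "card \<F> \<le> card {F \<in> nsets {1..n} k. T \<subseteq> F}"
      by (intro card_mono) (simp_all add: finite_imp_finite_nsets)
    then show "card \<F> = card {F \<in> nsets {1..n} k. T \<subseteq> F}"
      using max[OF star_almost_intersecting[OF T(2,1)]] by simp
  qed
  then show ?thesis
    using family_iso_star[OF \<open>T \<subseteq> {1..n}\<close>, of "{1..t}" k] T(2) \<open>t \<le> n\<close> by simp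
qed

end
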